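(* Let $a_0,b_0,c_0>0$, put $\eta_0=a_0b_0+b_0c_0+c_0a_0$ and $x_0=a_0/\eta_0$, $y_0=b_0/\eta_0$, $z_0=c_0/\eta_0$. Consider the system of recursive equations, for all $n\ge 1$, $$x_{n-1}=x_n+\phi(x_n;y_n,z_n),\qquad y_{n-1}=y_n+\phi(y_n;z_n,x_n),\qquad z_{n-1}=z_n+\phi(z_n;x_n,y_n),\qquad (\ast)$$ where $\phi(x;y,z)=\dfrac{(x+y)(x+z)}{2(x+y+z)}$. Then there exists a sequence of triples $(x_n,y_n,z_n)$, $n\ge 1$, of positive numbers which, together with the given $(x_0,y_0,z_0)$, satisfies $(\ast)$ for all $n\geq 1$ if and only if $x_0\ge y_0=z_0>0$ or one of the symmetric alternatives ($y_0\ge z_0=x_0>0$ or $z_0\ge x_0=y_0>0$) holds. Moreover, in the case $x_0\ge y_0=z_0>0$ one has $x_n\ge y_n=z_n>0$ for all $n\ge 0$ (and correspondingly, with the roles of the coordinates permuted, in the symmetric alternatives), and the positive sequence $\{(x_n,y_n,z_n)\}_{n\ge 0}$ is uniquely determined by the initial data $(x_0,y_0,z_0)$.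
   Context: The quantities $(x_n,y_n,z_n)$ are the resistances of the Y-shaped network equivalent, under the $\Delta$-Y transform, to the triangular network with conductances $(a_n,b_n,c_n)$ placed on each level-$n$ cell of the Sierpinski gasket; the system $(\ast)$ expresses compatibility of the level-$n$ and level-$(n-1)$ networks. All that is needed for the statement is given in the claim. *)

theory Defs
  imports Complex_Main
begin

definition phi :: "real \<Rightarrow> real \<Rightarrow> real \<Rightarrow> real" where
  "phi x y z = (x + y) * (x + z) / (2 * (x + y + z))"

definition satisfies_recursion ::
    "(nat \<Rightarrow> real) \<Rightarrow> (nat \<Rightarrow> real) \<Rightarrow> (nat \<Rightarrow> real) \<Rightarrow> bool" where
  "satisfies_recursion x y z \<longleftrightarrow>
     (\<forall>n\<ge>1. x (n - 1) = x n + phi (x n) (y n) (z n) \<and>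
            y (n - 1) = y n + phi (y n) (z n) (x n) \<and>
            z (n - 1) = z n + phi (z n) (x n) (y n))"

text \<open>Positivity is only required for indices \<open>n \<ge> 1\<close>: the initial triple is given data.\<close>

definition positive_solution ::
    "real \<Rightarrow> real \<Rightarrow> real \<Rightarrow> (nat \<Rightarrow> real) \<Rightarrow> (nat \<Rightarrow> real) \<Rightarrow> (nat \<Rightarrow> real) \<Rightarrow> bool" where
  "positive_solution x0 y0 z0 x y z \<longleftrightarrow>
     x 0 = x0 \<and> y 0 = y0 \<and> z 0 = z0 \<and>
     (\<forall>n\<ge>1. x n > 0 \<and> y n > 0 \<and> z n > 0) \<and>
     satisfies_recursion x y z"

end

theory Submission
  imports Defs
begin

text \<open>
  With \<open>s = x + y + z\<close> one has \<open>phi x y z = x/2 + y*z/(2*s)\<close>. Going from level \<open>n\<close> to level \<open>n - 1\<close>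
  therefore multiplies the total \<open>s\<close> by at least \<open>3/2\<close>, and it multiplies each difference, say
  \<open>y - z\<close>, by exactly \<open>3/2 - x/(2*s)\<close>, which lies strictly between \<open>1\<close> and \<open>3/2\<close>. In particular
  the signs of all differences are the same on every level (\<open>sgn_difference_invariant\<close>).

  Suppose that \<open>x\<close> is the largest coordinate. Then \<open>x/s\<close> is at least \<open>1/3\<close>, and \<open>y - z\<close> is multiplied
  by at most \<open>4/3\<close>. Read in the direction of increasing \<open>n\<close>, the total decays at least as fast as
  \<open>(2/3)^n\<close>, whereas \<open>y - z\<close> decays at most as fast as \<open>(3/4)^n\<close>. A positive triple satisfies
  \<open>\<bar>y - z\<bar> \<le> s\<close>, so an infinite positive solution must have \<open>y = z\<close>
  (\<open>smaller_coordinates_equal\<close>).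

  On the plane \<open>y = z\<close> a step is governed by the ratio \<open>t = x/y\<close>, which is mapped to
  \<open>(3*t^2 + 6*t + 1)/(4*t + 6)\<close>. This is an increasing bijection of the interval from \<open>1\<close> to infinity
  onto itself, and it is injective on all positive \<open>t\<close>; the scale is then recovered because the step is
  homogeneous of degree 1. So a triple with \<open>x \<ge> y = z > 0\<close> has exactly one positive preimage on
  that plane, and this preimage again satisfies \<open>x \<ge> y = z\<close>. Iterating it gives existence, and
  it gives uniqueness too, because the invariance of signs keeps every solution on the plane. The
  other two cases follow by rotating the coordinates.
\<close>

section \<open>One step of the recursion\<close>

lemma phi_eq:
  assumes "x + y + z \<noteq> 0"
  shows "phi x y z = x / 2 + y * z / (2 * (x + y + z))"
  using assms unfolding phi_def by (simp add: divide_simps) algebra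

lemma phi_swap: "phi x z y = phi x y z"
  unfolding phi_def by (simp add: algebra_simps)

lemma step_difference:
  assumes "x + y + z \<noteq> 0"
  shows "(y + phi y z x) - (z + phi z x y) = (3 / 2 - x / (2 * (x + y + z))) * (y - z)"
proof -
  have s: "y + z + x = x + y + z" "z + x + y = x + y + z"
    by simp_all
  have "phi y z x = y / 2 + z * x / (2 * (x + y + z))"
    and "phi z x y = z / 2 + x * y / (2 * (x + y + z))"
    using phi_eq[of y z x] phi_eq[of z x y] assms unfolding s by simp_all
  then show ?thesis
    using assms by (simp add: divide_simps) algebra
qed

lemma step_sum_ge:
  assumes "x > 0" "y > 0" "z > 0"
  shows "3 / 2 * (x + y + z) \<le> (x + phi x y z) + (y + phi y z x) + (z + phi z x y)"
proof -
  have "x / 2 \<le> phi x y z" "y / 2 \<le> phi y z x" "z / 2 \<le> phi z x y"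
    using assms phi_eq[of x y z] phi_eq[of y z x] phi_eq[of z x y] by simp_all
  then show ?thesis
    by simp
qed

section \<open>Symmetry and positivity of solutions\<close>

lemma positive_solution_rotate:
  assumes "positive_solution x0 y0 z0 x y z"
  shows "positive_solution y0 z0 x0 y z x"
  using assms unfolding positive_solution_def satisfies_recursion_def by blast

lemma positive_solution_step:
  assumes "positive_solution x0 y0 z0 x y z"
  shows "x n = x (Suc n) + phi (x (Suc n)) (y (Suc n)) (z (Suc n))"
    and "y n = y (Suc n) + phi (y (Suc n)) (z (Suc n)) (x (Suc n))"
    and "z n = z (Suc n) + phi (z (Suc n)) (x (Suc n)) (y (Suc n))"
proof -
  have "\<forall>m\<ge>1. x (m - 1) = x m + phi (x m) (y m) (z m) \<and>
      y (m - 1) = y m + phi (y m) (z m) (x m) \<and> z (m - 1) = z m + phi (z m) (x m) (y m)"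
    using assms unfolding positive_solution_def satisfies_recursion_def by blast
  from this[rule_format, of "Suc n"]
  show "x n = x (Suc n) + phi (x (Suc n)) (y (Suc n)) (z (Suc n))"
    and "y n = y (Suc n) + phi (y (Suc n)) (z (Suc n)) (x (Suc n))"
    and "z n = z (Suc n) + phi (z (Suc n)) (x (Suc n)) (y (Suc n))"
    by simp_all
qed

lemma positive_solution_pos_Suc:
  assumes "positive_solution x0 y0 z0 x y z"
  shows "x (Suc n) > 0" "y (Suc n) > 0" "z (Suc n) > 0"
  using assms unfolding positive_solution_def by simp_all

text \<open>
  A solution is required to be positive from index \<open>1\<close> on; index \<open>0\<close> inherits this, since \<open>phi\<close> is
  positive on positive triples.
\<close>

lemma positive_solution_pos:
  assumes "positive_solution x0 y0 z0 x y z"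
  shows "x n > 0" "y n > 0" "z n > 0"
proof -
  have first: "u n > 0" if "positive_solution u0 v0 w0 u v w" for u0 v0 w0 u v w
    unfolding positive_solution_step(1)[OF that, of n] phi_def
    using positive_solution_pos_Suc[OF that, of n]
    by (intro add_pos_pos divide_pos_pos mult_pos_pos) simp_all
  show "x n > 0" "y n > 0" "z n > 0"
    using first assms positive_solution_rotate by metis+
qed

section \<open>Decay of the differences and of the total\<close>

text \<open>
  The multiplier in \<open>step_difference\<close> is positive, as \<open>x\<close> is less than the total.
\<close>

lemma sgn_difference_invariant:
  assumes sol: "positive_solution x0 y0 z0 x y z"
  shows "sgn (y n - z n) = sgn (y0 - z0)"
proof (induction n)
  case 0
  then show ?case
    using sol by (simp add: positive_solution_def)
next
  case (Suc n)
  let ?s = "x (Suc n) + y (Suc n) + z (Suc n)"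
  note pos = positive_solution_pos[OF sol, of "Suc n"]
  have "y n - z n = (3 / 2 - x (Suc n) / (2 * ?s)) * (y (Suc n) - z (Suc n))"
    using step_difference[of "x (Suc n)" "y (Suc n)" "z (Suc n)"] pos
      positive_solution_step(2,3)[OF sol, of n] by simp
  moreover have "3 / 2 - x (Suc n) / (2 * ?s) > 0"
    using pos by (simp add: field_simps)
  ultimately have "sgn (y n - z n) = sgn (y (Suc n) - z (Suc n))"
    by (simp add: sgn_mult)
  with Suc show ?case
    by simp
qed

lemma order_invariant:
  assumes "positive_solution x0 y0 z0 x y z"
  shows "y n \<le> z n \<longleftrightarrow> y0 \<le> z0" and "y n = z n \<longleftrightarrow> y0 = z0"
  using sgn_difference_invariant[OF assms, of n] by (auto simp: sgn_if split: if_splits)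

lemma sum_decay:
  assumes sol: "positive_solution x0 y0 z0 x y z"
  shows "(3 / 2) ^ n * (x n + y n + z n) \<le> x0 + y0 + z0"
proof (induction n)
  case 0
  then show ?case
    using sol by (simp add: positive_solution_def)
next
  case (Suc n)
  have "3 / 2 * (x (Suc n) + y (Suc n) + z (Suc n)) \<le> x n + y n + z n"
    using step_sum_ge[OF positive_solution_pos[OF sol, of "Suc n"]]
    by (simp add: positive_solution_step[OF sol, of n, symmetric])
  then have "(3 / 2) ^ n * (3 / 2 * (x (Suc n) + y (Suc n) + z (Suc n)))
      \<le> (3 / 2) ^ n * (x n + y n + z n)"
    by (rule mult_left_mono) simp
  also note Suc
  finally show ?case
    by (simp only: power_Suc mult_ac)
qed

text \<open>
  The largest coordinate is at least a third of the total, so the multiplier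
  \<open>3/2 - x/(2*s)\<close> of the difference \<open>y - z\<close> is at most \<open>4/3\<close>.
\<close>

lemma difference_decay:
  assumes sol: "positive_solution x0 y0 z0 x y z" and max: "y0 \<le> x0" "z0 \<le> x0"
  shows "\<bar>y0 - z0\<bar> \<le> (4 / 3) ^ n * \<bar>y n - z n\<bar>"
proof (induction n)
  case 0
  then show ?case
    using sol by (simp add: positive_solution_def)
next
  case (Suc n)
  let ?s = "x (Suc n) + y (Suc n) + z (Suc n)"
  note pos = positive_solution_pos[OF sol, of "Suc n"]
  note sol' = positive_solution_rotate[OF sol]
  note sol'' = positive_solution_rotate[OF sol']
  have "z (Suc n) \<le> x (Suc n)" "y (Suc n) \<le> x (Suc n)"
    using order_invariant[OF sol', of "Suc n"] order_invariant[OF sol'', of "Suc n"] max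
    by auto
  then have c: "0 \<le> 3 / 2 - x (Suc n) / (2 * ?s)" "3 / 2 - x (Suc n) / (2 * ?s) \<le> 4 / 3"
    using pos by (simp_all add: field_simps)
  have "y n - z n = (3 / 2 - x (Suc n) / (2 * ?s)) * (y (Suc n) - z (Suc n))"
    using step_difference[of "x (Suc n)" "y (Suc n)" "z (Suc n)"] pos
      positive_solution_step(2,3)[OF sol, of n] by simp
  then have "\<bar>y n - z n\<bar> = (3 / 2 - x (Suc n) / (2 * ?s)) * \<bar>y (Suc n) - z (Suc n)\<bar>"
    by (simp only: abs_mult abs_of_nonneg[OF c(1)])
  also have "\<dots> \<le> 4 / 3 * \<bar>y (Suc n) - z (Suc n)\<bar>"
    by (rule mult_right_mono[OF c(2)]) simp
  finally have "\<bar>y n - z n\<bar> \<le> 4 / 3 * \<bar>y (Suc n) - z (Suc n)\<bar>" .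
  then have "(4 / 3) ^ n * \<bar>y n - z n\<bar> \<le> (4 / 3) ^ n * (4 / 3 * \<bar>y (Suc n) - z (Suc n)\<bar>)"
    by (rule mult_left_mono) simp
  with Suc have "\<bar>y0 - z0\<bar> \<le> (4 / 3) ^ n * (4 / 3 * \<bar>y (Suc n) - z (Suc n)\<bar>)"
    by (rule order.trans)
  then show ?case
    by (simp add: mult_ac)
qed

text \<open>
  Combining the two rates, \<open>\<bar>y0 - z0\<bar>\<close> is at most \<open>(4/3 * 2/3)^n = (8/9)^n\<close> times the initial total.
\<close>

lemma smaller_coordinates_equal:
  assumes sol: "positive_solution x0 y0 z0 x y z" and max: "y0 \<le> x0" "z0 \<le> x0"
  shows "y0 = z0"
proof -
  have "\<bar>y0 - z0\<bar> \<le> (8 / 9) ^ n * (x0 + y0 + z0)" for n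
  proof -
    have "\<bar>y0 - z0\<bar> \<le> (4 / 3) ^ n * \<bar>y n - z n\<bar>"
      by (rule difference_decay[OF sol max])
    also have "\<dots> \<le> (4 / 3) ^ n * (x n + y n + z n)"
      using positive_solution_pos[OF sol, of n] by (intro mult_left_mono) auto
    also have "\<dots> = (8 / 9) ^ n * ((3 / 2) ^ n * (x n + y n + z n))"
      by (simp flip: power_mult_distrib mult.assoc)
    also have "\<dots> \<le> (8 / 9) ^ n * (x0 + y0 + z0)"
      by (intro mult_left_mono sum_decay[OF sol]) simp
    finally show ?thesis .
  qed
  moreover have "(\<lambda>n. (8 / 9) ^ n * (x0 + y0 + z0)) \<longlonglongrightarrow> 0"
    by (intro tendsto_mult_left_zero LIMSEQ_realpow_zero) simp_all
  ultimately have "\<bar>y0 - z0\<bar> \<le> 0"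
    by (intro LIMSEQ_le_const) auto
  then show ?thesis
    by simp
qed

section \<open>The recursion on the plane of two equal coordinates\<close>

lemma diagonal_step:
  assumes "x > 0" "y > 0"
  shows "x + phi x y y = (3 * x\<^sup>2 + 6 * x * y + y\<^sup>2) / (2 * (x + 2 * y))"
    and "y + phi y y x = y * (2 * x + 3 * y) / (x + 2 * y)"
proof -
  have ne: "x + 2 * y \<noteq> 0"
    using assms by simp
  have s: "x + y + y = x + 2 * y" "y + y + x = x + 2 * y"
    by simp_all
  show "x + phi x y y = (3 * x\<^sup>2 + 6 * x * y + y\<^sup>2) / (2 * (x + 2 * y))"
    using ne unfolding phi_def s by (simp add: divide_simps) algebra
  show "y + phi y y x = y * (2 * x + 3 * y) / (x + 2 * y)"
    using ne unfolding phi_def s by (simp add: divide_simps) algebra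
qed

text \<open>
  Equal images have equal ratios of coordinates. In cross-multiplied form the difference of these ratios
  is \<open>x*v - u*y\<close> times a positive factor, so \<open>x/y = u/v\<close>; homogeneity then fixes the scale.
\<close>

lemma diagonal_step_inj:
  assumes pos: "x > 0" "y > 0" "u > 0" "v > 0"
    and eq: "x + phi x y y = u + phi u v v" "y + phi y y x = v + phi v v u"
  shows "x = u" and "y = v"
proof -
  let ?P = "3 * x\<^sup>2 + 6 * x * y + y\<^sup>2" and ?Q = "3 * u\<^sup>2 + 6 * u * v + v\<^sup>2"
  have "?P * (2 * (u + 2 * v)) = ?Q * (2 * (x + 2 * y))"
    using eq(1) pos unfolding diagonal_step(1)[OF pos(1,2)] diagonal_step(1)[OF pos(3,4)]
    by (subst (asm) frac_eq_eq) simp_all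
  then have X: "?P * (u + 2 * v) = ?Q * (x + 2 * y)"
    by algebra
  have Y: "y * (2 * x + 3 * y) * (u + 2 * v) = v * (2 * u + 3 * v) * (x + 2 * y)"
    using eq(2) pos unfolding diagonal_step(2)[OF pos(1,2)] diagonal_step(2)[OF pos(3,4)]
    by (subst (asm) frac_eq_eq) simp_all
  have "(?P * (u + 2 * v)) * (v * (2 * u + 3 * v) * (x + 2 * y))
      = (?Q * (x + 2 * y)) * (y * (2 * x + 3 * y) * (u + 2 * v))"
    by (simp only: X Y)
  then have "(?P * (v * (2 * u + 3 * v))) * ((x + 2 * y) * (u + 2 * v))
      = (?Q * (y * (2 * x + 3 * y))) * ((x + 2 * y) * (u + 2 * v))"
    by (simp only: mult_ac)
  then have "?P * (v * (2 * u + 3 * v)) = ?Q * (y * (2 * x + 3 * y))"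
    using pos by simp
  then have "(x * v - u * y) * (6 * x * u + 9 * (x * v + u * y) + 16 * y * v) = 0"
    by algebra
  moreover have "6 * x * u + 9 * (x * v + u * y) + 16 * y * v > 0"
    using pos by (intro add_pos_pos mult_pos_pos) simp_all
  ultimately have ratio: "x * v = u * y"
    by simp
  have "(y - v) * (2 * x * u + 7 * x * v + 6 * y * v) = 0"
    using Y ratio by algebra
  moreover have "2 * x * u + 7 * x * v + 6 * y * v > 0"
    using pos by (intro add_pos_pos mult_pos_pos) simp_all
  ultimately show "y = v"
    by simp
  with ratio pos show "x = u"
    by simp
qed

text \<open>
  Dividing the two equations leaves a quadratic equation for \<open>x/y\<close>, whose positive root is at least \<open>1\<close>
  because \<open>X/Y\<close> is; the second equation then determines \<open>y\<close>.
\<close>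

lemma diagonal_preimage:
  assumes "Y > 0" "X \<ge> Y"
  obtains x y where "x \<ge> y" "y > 0" "x + phi x y y = X" "y + phi y y x = Y"
proof -
  define r where "r = X / Y"
  have r: "r \<ge> 1" and X: "X = r * Y"
    using assms by (simp_all add: r_def)
  define q where "q = sqrt (4 * r\<^sup>2 + 6 * r + 6)"
  \<comment> \<open>The positive root of \<open>3*t^2 + 6*t + 1 = r*(4*t + 6)\<close>.\<close>
  define t where "t = (2 * r - 3 + q) / 3"
  have "1 \<le> r\<^sup>2"
    using r by simp
  then have "16 \<le> 4 * r\<^sup>2 + 6 * r + 6"
    using r by linarith
  then have "q \<ge> 4"
    unfolding q_def by (intro real_le_rsqrt) simp
  then have t: "t \<ge> 1"
    using r by (simp add: t_def)
  have "q\<^sup>2 = 4 * r\<^sup>2 + 6 * r + 6"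
    using r by (simp add: q_def)
  moreover have "q = 3 * t + 3 - 2 * r"
    by (simp add: t_def field_simps)
  ultimately have root: "3 * t\<^sup>2 + 6 * t + 1 = r * (4 * t + 6)"
    by algebra
  define y where "y = Y * (t + 2) / (2 * t + 3)"
  have y: "y > 0"
    using assms t by (simp add: y_def)
  have ty: "t * y > 0"
    using t y by simp
  have scale: "y * (2 * t + 3) = Y * (t + 2)"
    using t by (simp add: y_def)
  show ?thesis
  proof (rule that[of y "t * y"])
    show "y \<le> t * y"
      using t y by simp
    have "3 * (t * y)\<^sup>2 + 6 * (t * y) * y + y\<^sup>2 = X * (2 * (t * y + 2 * y))"
      using root scale X by algebra
    then show "t * y + phi (t * y) y y = X"
      using y ty by (simp add: diagonal_step(1)[OF ty y] divide_eq_eq)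
    have "y * (2 * (t * y) + 3 * y) = Y * (t * y + 2 * y)"
      using scale by algebra
    then show "y + phi y y (t * y) = Y"
      using y ty by (simp add: diagonal_step(2)[OF ty y] divide_eq_eq)
  qed (fact y)
qed

section \<open>Existence and uniqueness\<close>

text \<open>
  The preimage delivered by \<open>diagonal_preimage\<close> meets the hypotheses of that lemma again, so preimages
  can be chosen one after the other.
\<close>

lemma positive_solution_exists:
  assumes "x0 \<ge> y0" "y0 = z0" "z0 > 0"
  shows "\<exists>x y z. positive_solution x0 y0 z0 x y z"
proof -
  have "\<exists>f. \<forall>n. (fst (f n) \<ge> snd (f n) \<and> snd (f n) > 0 \<and> (n = 0 \<longrightarrow> f n = (x0, y0))) \<and>
      fst (f (Suc n)) + phi (fst (f (Suc n))) (snd (f (Suc n))) (snd (f (Suc n))) = fst (f n) \<and>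
      snd (f (Suc n)) + phi (snd (f (Suc n))) (snd (f (Suc n))) (fst (f (Suc n))) = snd (f n)"
  proof (rule dependent_nat_choice)
    fix p :: "real \<times> real" and n :: nat
    assume "snd p \<le> fst p \<and> 0 < snd p \<and> (n = 0 \<longrightarrow> p = (x0, y0))"
    then obtain x y where "x \<ge> y" "y > 0" "x + phi x y y = fst p" "y + phi y y x = snd p"
      using diagonal_preimage by metis
    then show "\<exists>q. (snd q \<le> fst q \<and> 0 < snd q \<and> (Suc n = 0 \<longrightarrow> q = (x0, y0))) \<and>
        fst q + phi (fst q) (snd q) (snd q) = fst p \<and>
        snd q + phi (snd q) (snd q) (fst q) = snd p"
      by (intro exI[of _ "(x, y)"]) simp
  qed (use assms in auto)
  then obtain f where f: "\<And>n. fst (f n) \<ge> snd (f n)" "\<And>n. snd (f n) > 0" "f 0 = (x0, y0)"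
    and step:
      "\<And>n. fst (f (Suc n)) + phi (fst (f (Suc n))) (snd (f (Suc n))) (snd (f (Suc n))) = fst (f n)"
      "\<And>n. snd (f (Suc n)) + phi (snd (f (Suc n))) (snd (f (Suc n))) (fst (f (Suc n))) = snd (f n)"
    by blast
  let ?x = "\<lambda>n. fst (f n)" and ?y = "\<lambda>n. snd (f n)"
  have pos: "fst (f n) > 0" for n
    using f(1,2)[of n] by simp
  have "?x (n - 1) = ?x n + phi (?x n) (?y n) (?y n) \<and> ?y (n - 1) = ?y n + phi (?y n) (?y n) (?x n)"
    if "n \<ge> 1" for n
    using step[of "n - 1"] that by simp
  then have "satisfies_recursion ?x ?y ?y"
    unfolding satisfies_recursion_def by (simp add: phi_swap)
  then have "positive_solution x0 y0 z0 ?x ?y ?y"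
    using f pos assms by (simp add: positive_solution_def)
  then show ?thesis
    by blast
qed

lemma positive_solution_order:
  assumes sol: "positive_solution x0 y0 z0 x y z" and init: "x0 \<ge> y0" "y0 = z0"
  shows "x n \<ge> y n \<and> y n = z n \<and> z n > 0"
  using order_invariant[OF sol, of n] positive_solution_pos[OF sol, of n] init
    order_invariant[OF positive_solution_rotate[OF positive_solution_rotate[OF sol]], of n]
    order_invariant[OF positive_solution_rotate[OF sol], of n]
  by auto

lemma positive_solution_unique:
  assumes sol: "positive_solution x0 y0 z0 x y z"
    and sol': "positive_solution x0 y0 z0 x' y' z'"
    and init: "x0 \<ge> y0" "y0 = z0"
  shows "x = x' \<and> y = y' \<and> z = z'"
proof -
  have diag: "z n = y n" "z' n = y' n" for n
    using positive_solution_order[OF sol init, of n] positive_solution_order[OF sol' init, of n]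
    by simp_all
  have "x n = x' n \<and> y n = y' n" for n
  proof (induction n)
    case 0
    then show ?case
      using sol sol' by (simp add: positive_solution_def)
  next
    case (Suc n)
    have "x (Suc n) + phi (x (Suc n)) (y (Suc n)) (y (Suc n))
        = x' (Suc n) + phi (x' (Suc n)) (y' (Suc n)) (y' (Suc n))"
      using positive_solution_step(1)[OF sol, of n] positive_solution_step(1)[OF sol', of n] Suc
      by (simp add: diag)
    moreover have "y (Suc n) + phi (y (Suc n)) (y (Suc n)) (x (Suc n))
        = y' (Suc n) + phi (y' (Suc n)) (y' (Suc n)) (x' (Suc n))"
      using positive_solution_step(2)[OF sol, of n] positive_solution_step(2)[OF sol', of n] Suc
      by (simp add: diag)
    ultimately show ?case
      using diagonal_step_inj[OF positive_solution_pos(1,2)[OF sol, of "Suc n"]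
          positive_solution_pos(1,2)[OF sol', of "Suc n"]] by simp
  qed
  then show ?thesis
    using diag by (simp add: fun_eq_iff)
qed

theorem proposition1p1:
  fixes a0 b0 c0 eta0 x0 y0 z0 :: real
  assumes "a0 > 0" and "b0 > 0" and "c0 > 0"
    and "eta0 = a0 * b0 + b0 * c0 + c0 * a0"
    and "x0 = a0 / eta0" and "y0 = b0 / eta0" and "z0 = c0 / eta0"
  shows
    "((\<exists>x y z. positive_solution x0 y0 z0 x y z) \<longleftrightarrow>
        (x0 \<ge> y0 \<and> y0 = z0 \<and> z0 > 0) \<or>
        (y0 \<ge> z0 \<and> z0 = x0 \<and> x0 > 0) \<or>
        (z0 \<ge> x0 \<and> x0 = y0 \<and> y0 > 0)) \<and>
     (\<forall>x y z. positive_solution x0 y0 z0 x y z \<longrightarrow>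
        (x0 \<ge> y0 \<and> y0 = z0 \<and> z0 > 0 \<longrightarrow> (\<forall>n. x n \<ge> y n \<and> y n = z n \<and> z n > 0)) \<and>
        (y0 \<ge> z0 \<and> z0 = x0 \<and> x0 > 0 \<longrightarrow> (\<forall>n. y n \<ge> z n \<and> z n = x n \<and> x n > 0)) \<and>
        (z0 \<ge> x0 \<and> x0 = y0 \<and> y0 > 0 \<longrightarrow> (\<forall>n. z n \<ge> x n \<and> x n = y n \<and> y n > 0))) \<and>
     (\<forall>x y z x' y' z'. positive_solution x0 y0 z0 x y z \<longrightarrow>
        positive_solution x0 y0 z0 x' y' z' \<longrightarrow> x = x' \<and> y = y' \<and> z = z')"
proof -
  let ?A = "x0 \<ge> y0 \<and> y0 = z0 \<and> z0 > 0" and ?B = "y0 \<ge> z0 \<and> z0 = x0 \<and> x0 > 0"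
    and ?C = "z0 \<ge> x0 \<and> x0 = y0 \<and> y0 > 0"
  note rotate = positive_solution_rotate
  note rotate2 = rotate[OF rotate]
  have alternatives: "?A \<or> ?B \<or> ?C" if sol: "positive_solution x0 y0 z0 x y z" for x y z
  proof -
    have pos: "x0 > 0" "y0 > 0" "z0 > 0"
      using positive_solution_pos[OF sol, of 0] sol by (simp_all add: positive_solution_def)
    consider "y0 \<le> x0" "z0 \<le> x0" | "z0 \<le> y0" "x0 \<le> y0" | "x0 \<le> z0" "y0 \<le> z0"
      by linarith
    then show ?thesis
    proof cases
      case 1
      with smaller_coordinates_equal[OF sol] pos show ?thesis by blast
    next
      case 2
      with smaller_coordinates_equal[OF rotate[OF sol]] pos show ?thesis by blast
    next
      case 3
      with smaller_coordinates_equal[OF rotate2[OF sol]] pos show ?thesis by blast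
    qed
  qed
  have existence: "\<exists>x y z. positive_solution x0 y0 z0 x y z" if "?A \<or> ?B \<or> ?C"
    using that
  proof (elim disjE)
    assume ?A
    then show ?thesis
      using positive_solution_exists by blast
  next
    assume ?B
    then show ?thesis
      using positive_solution_exists[of z0 y0 x0] rotate2 by blast
  next
    assume ?C
    then show ?thesis
      using positive_solution_exists[of x0 z0 y0] rotate by blast
  qed
  have order: "(?A \<longrightarrow> (\<forall>n. x n \<ge> y n \<and> y n = z n \<and> z n > 0)) \<and>
      (?B \<longrightarrow> (\<forall>n. y n \<ge> z n \<and> z n = x n \<and> x n > 0)) \<and>
      (?C \<longrightarrow> (\<forall>n. z n \<ge> x n \<and> x n = y n \<and> y n > 0))"
    if sol: "positive_solution x0 y0 z0 x y z" for x y z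
    using positive_solution_order[OF sol] positive_solution_order[OF rotate[OF sol]]
      positive_solution_order[OF rotate2[OF sol]] by blast
  have unique: "x = x' \<and> y = y' \<and> z = z'"
    if sol: "positive_solution x0 y0 z0 x y z" and sol': "positive_solution x0 y0 z0 x' y' z'"
    for x y z x' y' z'
    using alternatives[OF sol] positive_solution_unique[OF sol sol']
      positive_solution_unique[OF rotate[OF sol] rotate[OF sol']]
      positive_solution_unique[OF rotate2[OF sol] rotate2[OF sol']] by blast
  show ?thesis
    by (intro conjI) (use alternatives existence in blast, use order in blast, use unique in blast)
qed

end
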